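(* Let $0<\gamma<1$. Then there exists a sequence $(x_n)_{n\in\mathbb{N}}\subseteq[0,1]$ that has $\gamma$-PPC but is not uniformly distributed modulo $1$.
   Context: For $x\in\mathbb{R}$, $\|x\|=\min\{|x-k|:k\in\mathbb{Z}\}$ denotes the distance to the nearest integer. For a sequence $(x_n)_{n\in\mathbb{N}}\subseteq[0,1]$, $\gamma\in\mathbb{R}$, $s>0$ and $N\in\mathbb{N}$, define $$R_2(\gamma;s,N)=\frac{1}{N}\#\Big\{1\leqslant m\neq n\leqslant N:\ \|x_m-x_n-\gamma\|\leqslant \frac{s}{N}\Big\}.$$ The sequence has $\gamma$-PPC ($\gamma$-Poissonian pair correlations) if $\lim_{N\to\infty}R_2(\gamma;s,N)=2s$ for all $s>0$. *)

theory Defs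
  imports "HOL-Analysis.Analysis"
begin

(* The minimum of the infinite set is written as an infimum; it is attained, see nearest_int_dist_attained. *)
definition nearest_int_dist :: "real \<Rightarrow> real" where
  "nearest_int_dist x = (INF k::int. \<bar>x - of_int k\<bar>)"

lemma nearest_int_dist_le: "nearest_int_dist x \<le> \<bar>x - of_int k\<bar>"
  unfolding nearest_int_dist_def
  by (rule cINF_lower) (auto intro: bdd_belowI[where m = 0])

lemma nearest_int_dist_attained: "\<exists>k::int. nearest_int_dist x = \<bar>x - of_int k\<bar>"
proof -
  have "\<bar>x - of_int (round x)\<bar> \<le> nearest_int_dist x"
    unfolding nearest_int_dist_def
    by (rule cINF_greatest) (auto simp: round_diff_minimal)
  then show ?thesis
    using nearest_int_dist_le[of x "round x"] by (intro exI[of _ "round x"]) linarith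
qed

(* Sequences are indexed from 1: the value at index 0 is never used. *)
definition R2 :: "(nat \<Rightarrow> real) \<Rightarrow> real \<Rightarrow> real \<Rightarrow> nat \<Rightarrow> real" where
  "R2 x \<gamma> s N =
     1 / real N *
     real (card {(m, n). m \<in> {1..N} \<and> n \<in> {1..N} \<and> m \<noteq> n \<and>
                   nearest_int_dist (x m - x n - \<gamma>) \<le> s / real N})"

definition has_PPC :: "real \<Rightarrow> (nat \<Rightarrow> real) \<Rightarrow> bool" where
  "has_PPC \<gamma> x \<longleftrightarrow> (\<forall>s>0. (\<lambda>N. R2 x \<gamma> s N) \<longlonglongrightarrow> 2 * s)"

definition uniformly_distributed_mod1 :: "(nat \<Rightarrow> real) \<Rightarrow> bool" where
  "uniformly_distributed_mod1 x \<longleftrightarrow>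
     (\<forall>a b. 0 \<le> a \<and> a < b \<and> b \<le> 1 \<longrightarrow>
        (\<lambda>N. real (card {n \<in> {1..N}. a \<le> frac (x n) \<and> frac (x n) < b}) / real N)
          \<longlonglongrightarrow> b - a)"

end

theory Submission
  imports Defs
begin

text \<open>
  Since \<open>\<gamma>\<close> is not an integer, only differences between two far apart clusters need to be
  controlled. In every group of \<open>q\<close> consecutive indices put one point \<open>\<gamma> + L * w\<close> and \<open>q - 1\<close>
  copies of a point \<open>L * u\<close>, where \<open>w\<close> and \<open>u\<close> run through the van der Corput sequences in the
  coprime bases \<open>3\<close> and \<open>2\<close>. For small \<open>L\<close>, only cross pairs can have a difference close to
  \<open>\<gamma>\<close> modulo \<open>1\<close>, and no point falls into \<open>[\<gamma> / 2, \<gamma>)\<close>.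

  A block of \<open>b ^ a\<close> consecutive terms of the base \<open>b\<close> sequence is a translate of the lattice of
  mesh \<open>1 / b ^ a\<close>. For coprime \<open>P\<close>, \<open>Q\<close> the differences of the lattices of mesh \<open>1 / P\<close> and
  \<open>1 / Q\<close> fill, modulo \<open>1\<close>, the lattice of mesh \<open>1 / (P * Q)\<close> exactly once, so two such blocks
  contribute \<open>2 * \<delta> * P * Q + O(1)\<close> pairs at distance at most \<open>\<delta>\<close>. With boundedly many blocks of
  length comparable to \<open>N\<close> this gives \<open>2 * \<delta> * N\<^sup>2\<close> asymptotically when \<open>\<delta>\<close> is of order
  \<open>1 / N\<close>. The length \<open>L\<close> is then chosen to normalise the limit to \<open>2 * s\<close>; for \<open>\<gamma> = 1 / 2\<close> every
  cross pair counts in both orders, which is the origin of the factor \<open>2\<close>.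
\<close>

section \<open>Van der Corput sequences and their blocks\<close>

text \<open>The radical inverse: the base \<open>b\<close> digits of \<open>n\<close> are mirrored
  at the radix point. The default for \<open>b < 2\<close> ensures that \<open>n div b\<close>
  decreases in every recursive call.\<close>

function vdc :: "nat \<Rightarrow> nat \<Rightarrow> real" where
  "vdc b n = (if n = 0 \<or> b < 2 then 0 else (real (n mod b) + vdc b (n div b)) / real b)"
  by auto
termination by (relation "Wellfounded.measure snd") auto

declare vdc.simps [simp del]

lemma vdc_0 [simp]: "vdc b 0 = 0"
  by (simp add: vdc.simps)

lemma vdc_digit:
  assumes "d < b" "2 \<le> b"
  shows "vdc b (n * b + d) = (real d + vdc b n) / real b"
proof (cases "n * b + d = 0")
  case True
  then show ?thesis using assms by simp
next
  case False
  then show ?thesis using assms by (subst vdc.simps) auto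
qed

lemma vdc_bounds:
  assumes "2 \<le> b"
  shows "0 \<le> vdc b n \<and> vdc b n < 1"
proof (induction n rule: less_induct)
  case (less n)
  show ?case
  proof (cases "n = 0")
    case False
    then have IH: "0 \<le> vdc b (n div b)" "vdc b (n div b) < 1"
      using less assms by auto
    have "n mod b + 1 \<le> b" using assms by (simp add: Suc_leI)
    then have "real (n mod b) + 1 \<le> real b" by (metis of_nat_1 of_nat_add of_nat_le_iff)
    then show ?thesis using IH assms False by (subst (1 2) vdc.simps) (auto simp: divide_simps)
  qed simp
qed

lemma sum_nat_group_offset:
  fixes f :: "nat \<Rightarrow> 'a::comm_monoid_add"
  shows "(\<Sum>n<m * k. f n) = (\<Sum>i<m. \<Sum>j<k. f (i * k + j))"
proof -
  have "sum f {i * k..<i * k + k} = (\<Sum>j<k. f (i * k + j))" for i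
    using sum.shift_bounds_nat_ivl[of f 0 "i * k" k] by (simp add: add.commute atLeast0LessThan)
  then show ?thesis using sum.nat_group[of f k m] by simp
qed

text \<open>The last \<open>a\<close> digits of the index take all possible values and become the
  leading \<open>a\<close> digits of the value, while \<open>c\<close> contributes only the constant
  shift \<open>vdc b c / b ^ a\<close>.\<close>

lemma sum_vdc_block:
  assumes b: "2 \<le> b"
  shows "(\<Sum>i<b ^ a. f (vdc b (c * b ^ a + i))) =
         (\<Sum>k<b ^ a. f ((real k + vdc b c) / real (b ^ a)) :: real)"
proof (induction a arbitrary: f)
  case (Suc a)
  have "(\<Sum>i<b ^ Suc a. f (vdc b (c * b ^ Suc a + i)))
      = (\<Sum>i<b ^ a. \<Sum>d<b. f (vdc b ((c * b ^ a + i) * b + d)))"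
    using sum_nat_group_offset[of "\<lambda>i. f (vdc b (c * b ^ Suc a + i))" "b ^ a" b]
    by (simp add: algebra_simps)
  also have "\<dots> = (\<Sum>i<b ^ a. \<Sum>d<b. f ((real d + vdc b (c * b ^ a + i)) / real b))"
    using b by (simp add: vdc_digit)
  also have "\<dots> = (\<Sum>d<b. \<Sum>i<b ^ a. f ((real d + vdc b (c * b ^ a + i)) / real b))"
    by (rule sum.swap)
  \<comment> \<open>The last digit \<open>d\<close> of the index leads the value. For fixed
    \<open>d\<close> the induction hypothesis is used with
    \<open>\<lambda>y. f ((d + y) / b)\<close>, which is why \<open>f\<close> is arbitrary in the
    induction.\<close>
  also have "\<dots> = (\<Sum>d<b. \<Sum>k<b ^ a. f ((real d + (real k + vdc b c) / real (b ^ a)) / real b))"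
    by (intro sum.cong[OF refl] Suc[of "\<lambda>y. f ((real _ + y) / real b)"])
  also have "\<dots> = (\<Sum>d<b. \<Sum>k<b ^ a. f ((real (d * b ^ a + k) + vdc b c) / real (b ^ Suc a)))"
    using b by (intro sum.cong refl arg_cong[where f = f]) (simp add: field_simps)
  also have "\<dots> = (\<Sum>k<b ^ Suc a. f ((real k + vdc b c) / real (b ^ Suc a)))"
    using sum_nat_group_offset[of "\<lambda>k. f ((real k + vdc b c) / real (b ^ Suc a))" b "b ^ a"]
    by simp
  finally show ?case .
qed simp

lemma sum_vdc_blocks:
  assumes "2 \<le> b"
  shows "(\<Sum>n<J * b ^ a. f (vdc b n)) =
         (\<Sum>c<J. \<Sum>k<b ^ a. f ((real k + vdc b c) / real (b ^ a)) :: real)"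
  using assms by (simp only: sum_nat_group_offset sum_vdc_block)

section \<open>Close pairs between two shifted lattices of coprime sizes\<close>

lemma card_int_interval:
  fixes A B :: real
  shows "real (card {k::int. A \<le> k \<and> k \<le> B}) \<ge> B - A - 1"
    and "A \<le> B \<Longrightarrow> real (card {k::int. A \<le> k \<and> k \<le> B}) \<le> B - A + 1"
    and "finite {k::int. A \<le> k \<and> k \<le> B}"
proof -
  have eq: "{k::int. A \<le> k \<and> k \<le> B} = {\<lceil>A\<rceil>..\<lfloor>B\<rfloor>}"
    by (auto simp: ceiling_le_iff le_floor_iff)
  show "real (card {k::int. A \<le> k \<and> k \<le> B}) \<ge> B - A - 1"
    unfolding eq by (simp, linarith)
  show "finite {k::int. A \<le> k \<and> k \<le> B}" unfolding eq by simp
  show "real (card {k::int. A \<le> k \<and> k \<le> B}) \<le> B - A + 1" if "A \<le> B"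
    unfolding eq using that by (simp, linarith)
qed

lemma card_nat_less:
  fixes X :: real
  shows "0 \<le> X \<Longrightarrow> real (card {i::nat. i < X}) \<le> X + 1"
    and "finite {i::nat. i < X}"
proof -
  have sub: "{i::nat. real i < X} \<subseteq> {..nat \<lfloor>X\<rfloor>}"
    by (auto simp: le_nat_floor)
  then show "finite {i::nat. real i < X}" by (rule finite_subset) simp
  assume "0 \<le> X"
  have "card {i::nat. real i < X} \<le> nat \<lfloor>X\<rfloor> + 1"
    using card_mono[OF _ sub] by simp
  then show "real (card {i::nat. i < X}) \<le> X + 1" using \<open>0 \<le> X\<close> by linarith
qed

text \<open>The shift \<open>t = 0\<close> stands for closeness on the real line,
  \<open>t = 1\<close> and \<open>t = -1\<close> for closeness across the ends of the unit
  interval.\<close>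

definition lattice_pairs :: "nat \<Rightarrow> nat \<Rightarrow> real \<Rightarrow> real \<Rightarrow> real \<Rightarrow> real \<Rightarrow> (nat \<times> nat) set" where
  "lattice_pairs P Q \<alpha> \<beta> t \<delta> =
     {(i, j). i < P \<and> j < Q \<and> \<bar>(real i + \<alpha>) / real P - (real j + \<beta>) / real Q - t\<bar> \<le> \<delta>}"

lemma finite_lattice_pairs: "finite (lattice_pairs P Q \<alpha> \<beta> t \<delta>)"
  unfolding lattice_pairs_def by (rule finite_subset[of _ "{..<P} \<times> {..<Q}"]) auto

text \<open>Clearing denominators turns closeness up to \<open>e\<close> into membership of an
  integer in a fixed window of length \<open>2 * \<delta> * P * Q\<close>.\<close>

lemma lattice_pairs_iff:
  assumes "0 < P" "0 < Q"
  shows "\<bar>(real i + \<alpha>) / real P - (real j + \<beta>) / real Q - real_of_int e\<bar> \<le> \<delta> \<longleftrightarrow>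
     \<bar>real_of_int (int Q * int i - int P * int j - e * int P * int Q) + (real Q * \<alpha> - real P * \<beta>)\<bar> \<le> \<delta> * P * Q"
proof -
  have "real_of_int (int Q * int i - int P * int j - e * int P * int Q) + (real Q * \<alpha> - real P * \<beta>)
     = ((real i + \<alpha>) / real P - (real j + \<beta>) / real Q - e) * (real P * real Q)"
    using assms by (simp add: field_simps)
  then show ?thesis using assms by (simp add: abs_mult mult.assoc)
qed

text \<open>By coprimality \<open>Q * i - P * j\<close> determines \<open>i\<close> modulo
  \<open>P\<close>, hence \<open>i\<close> and then \<open>j\<close>. The pairs therefore inject
  into the integers of a window of length \<open>2 * \<delta> * P * Q\<close>.\<close>

lemma card_lattice_pairs_le:
  assumes P: "0 < P" and Q: "0 < Q" and co: "coprime P Q" and "0 \<le> \<delta>"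
  shows "real (card (lattice_pairs P Q \<alpha> \<beta> 0 \<delta>)) \<le> 2 * \<delta> * P * Q + 1"
proof -
  define \<theta> where "\<theta> = real Q * \<alpha> - real P * \<beta>"
  let ?K = "{k::int. - \<theta> - \<delta> * P * Q \<le> k \<and> k \<le> - \<theta> + \<delta> * P * Q}"
  have inj: "inj_on (\<lambda>(i, j). int Q * int i - int P * int j) (lattice_pairs P Q \<alpha> \<beta> 0 \<delta>)"
  proof (rule inj_onI, clarify)
    fix i j i' j'
    assume ij: "(i, j) \<in> lattice_pairs P Q \<alpha> \<beta> 0 \<delta>" "(i', j') \<in> lattice_pairs P Q \<alpha> \<beta> 0 \<delta>"
      and eq: "int Q * int i - int P * int j = int Q * int i' - int P * int j'"
    have "int Q * (int i - int i') = int P * (int j - int j')"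
      using eq by (simp add: algebra_simps)
    then have "int P dvd int Q * (int i - int i')" by simp
    then have "int P dvd int i - int i'"
      using co by (simp add: coprime_dvd_mult_right_iff)
    moreover have "\<bar>int i - int i'\<bar> < \<bar>int P\<bar>"
      using ij by (auto simp: lattice_pairs_def)
    ultimately have "i = i'"
      using dvd_imp_le_int[of "int i - int i'" "int P"] by force
    then show "i = i' \<and> j = j'" using eq P by simp
  qed
  have "(\<lambda>(i, j). int Q * int i - int P * int j) ` lattice_pairs P Q \<alpha> \<beta> 0 \<delta> \<subseteq> ?K"
    using lattice_pairs_iff[OF P Q, of _ \<alpha> _ \<beta> 0 \<delta>]
    by (auto simp: lattice_pairs_def \<theta>_def abs_le_iff)
  from card_inj_on_le[OF inj this] card_int_interval(3)
  have "card (lattice_pairs P Q \<alpha> \<beta> 0 \<delta>) \<le> card ?K" by blast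
  also have "real (card ?K) \<le> 2 * \<delta> * P * Q + 1"
    using card_int_interval(2)[of "- \<theta> - \<delta> * P * Q" "- \<theta> + \<delta> * P * Q"] assms by simp
  finally show ?thesis by simp
qed

text \<open>Points of the unit interval differ by almost \<open>1\<close> only if the first is
  within \<open>\<delta>\<close> of \<open>1\<close> and the second within \<open>\<delta>\<close>
  of \<open>0\<close>; this leaves about \<open>\<delta> * P\<close> and \<open>\<delta> * Q\<close>
  indices.\<close>

lemma card_lattice_pairs_1_le:
  assumes P: "0 < P" and Q: "0 < Q" and ab: "\<alpha> \<in> {0..<1}" "\<beta> \<in> {0..<1}" and "0 \<le> \<delta>"
  shows "real (card (lattice_pairs P Q \<alpha> \<beta> 1 \<delta>)) \<le> (\<delta> * P + 2) * (\<delta> * Q + 2)"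
proof -
  let ?A = "{i::nat. i < \<delta> * P + 1}" and ?B = "{j::nat. j < \<delta> * Q + 1}"
  \<comment> \<open>Counting \<open>i\<close> from the top end makes both index ranges initial
    segments.\<close>
  have "lattice_pairs P Q \<alpha> \<beta> 1 \<delta> \<subseteq> (\<lambda>(i, j). (P - 1 - i, j)) ` (?A \<times> ?B)"
  proof clarify
    fix i j assume ij: "(i, j) \<in> lattice_pairs P Q \<alpha> \<beta> 1 \<delta>"
    then have lt: "i < P" "j < Q" by (auto simp: lattice_pairs_def)
    have "real i + 1 \<le> real P" "real j + 1 \<le> real Q" using lt by linarith+
    then have "(real i + \<alpha>) / P \<le> 1" "(real j + \<beta>) / Q \<ge> 0" using ab P by (auto simp: divide_simps)
    moreover have "(real i + \<alpha>) / P - (real j + \<beta>) / Q \<ge> 1 - \<delta>"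
      using ij by (auto simp: lattice_pairs_def)
    ultimately have "(real i + \<alpha>) / P \<ge> 1 - \<delta>" "(real j + \<beta>) / Q \<le> \<delta>" by linarith+
    then have 1: "real i + \<alpha> \<ge> (1 - \<delta>) * P" and 2: "real j + \<beta> \<le> \<delta> * Q"
      using P Q by (auto simp: field_simps)
    have "real (P - 1 - i) = real P - 1 - real i" using lt by (simp add: of_nat_diff)
    also have "\<dots> < \<delta> * P + 1" using 1 ab by (simp add: algebra_simps)
    finally have "P - 1 - i \<in> ?A" by simp
    moreover have "j \<in> ?B" using 2 ab by simp
    moreover have "i = P - 1 - (P - 1 - i)" using lt by simp
    ultimately show "(i, j) \<in> (\<lambda>(i, j). (P - 1 - i, j)) ` (?A \<times> ?B)"
      by (intro image_eqI[where x = "(P - 1 - i, j)"]) auto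
  qed
  then have "card (lattice_pairs P Q \<alpha> \<beta> 1 \<delta>) \<le> card (?A \<times> ?B)"
    by (intro surj_card_le) (simp_all add: card_nat_less(2))
  also have "real (card (?A \<times> ?B)) \<le> (\<delta> * P + 2) * (\<delta> * Q + 2)"
    using card_nat_less(1)[of "\<delta> * P + 1"] card_nat_less(1)[of "\<delta> * Q + 1"] \<open>0 \<le> \<delta>\<close>
    by (simp add: card_cartesian_product mult_mono)
  finally show ?thesis by simp
qed

text \<open>Exchanging the two lattices reverses the sign of the difference.\<close>

lemma card_lattice_pairs_m1_le:
  assumes P: "0 < P" and Q: "0 < Q" and ab: "\<alpha> \<in> {0..<1}" "\<beta> \<in> {0..<1}" and "0 \<le> \<delta>"
  shows "real (card (lattice_pairs P Q \<alpha> \<beta> (-1) \<delta>)) \<le> (\<delta> * P + 2) * (\<delta> * Q + 2)"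
proof -
  have "lattice_pairs P Q \<alpha> \<beta> (-1) \<delta> = prod.swap ` lattice_pairs Q P \<beta> \<alpha> 1 \<delta>"
    by (auto simp: lattice_pairs_def image_iff)
  then have "card (lattice_pairs P Q \<alpha> \<beta> (-1) \<delta>) = card (lattice_pairs Q P \<beta> \<alpha> 1 \<delta>)"
    by (simp add: card_image)
  then show ?thesis
    using card_lattice_pairs_1_le[OF Q P ab(2,1) \<open>0 \<le> \<delta>\<close>] by (simp add: mult.commute)
qed

text \<open>By the Chinese remainder theorem every integer is congruent modulo \<open>P * Q\<close> to some
  \<open>Q * i - P * j\<close>, and that difference lies strictly between \<open>- P * Q\<close> and \<open>P * Q\<close>; this is
  why the translates by \<open>1\<close> and \<open>-1\<close> have to be discarded.\<close>

lemma ex_coprime_difference: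
  fixes k :: int
  assumes P: "0 < P" and Q: "0 < Q" and co: "coprime P Q"
  obtains i j e where "i < P" "j < Q" "int Q * int i - int P * int j - e * int P * int Q = k"
proof -
  from co have "coprime (int P) (int Q)" by simp
  then obtain a b where ab: "a * int P + b * int Q = 1"
    using bezout_int[of "int P" "int Q"] by auto
  \<comment> \<open>Modulo \<open>P\<close> the product \<open>Q * i\<close> is
    \<open>k * b * Q\<close>, that is \<open>k\<close>; similarly for \<open>j\<close> modulo
    \<open>Q\<close>. The difference of the two quotients serves as \<open>e\<close>.\<close>
  define i where "i = nat ((k * b) mod int P)"
  define j where "j = nat ((- k * a) mod int Q)"
  have i: "int i = k * b - int P * ((k * b) div int P)"
    using P by (simp add: i_def minus_mult_div_eq_mod)
  have j: "int j = - k * a - int Q * ((- k * a) div int Q)"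
    using Q by (simp add: j_def minus_mult_div_eq_mod)
  have "i < P" "j < Q" using P Q by (simp_all add: i_def j_def nat_less_iff)
  moreover have "int Q * int i - int P * int j
      - ((- k * a) div int Q - (k * b) div int P) * int P * int Q = k * (a * int P + b * int Q)"
    unfolding i j by (simp add: algebra_simps)
  ultimately show ?thesis using that ab by simp
qed

text \<open>Every integer of the window comes from a pair with some shift \<open>e\<close>. As the
  points lie in \<open>[0, 1)\<close> and \<open>\<delta> < 1\<close>, only \<open>0\<close>,
  \<open>1\<close> and \<open>-1\<close> can occur, and the last two are few.\<close>

lemma card_lattice_pairs_ge:
  assumes P: "0 < P" and Q: "0 < Q" and co: "coprime P Q"
    and ab: "\<alpha> \<in> {0..<1}" "\<beta> \<in> {0..<1}" and d: "0 \<le> \<delta>" "\<delta> < 1"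
  shows "real (card (lattice_pairs P Q \<alpha> \<beta> 0 \<delta>)) \<ge> 2 * \<delta> * P * Q - 1 - 2 * (\<delta> * P + 2) * (\<delta> * Q + 2)"
proof -
  define \<theta> where "\<theta> = real Q * \<alpha> - real P * \<beta>"
  let ?K = "{k::int. - \<theta> - \<delta> * P * Q \<le> k \<and> k \<le> - \<theta> + \<delta> * P * Q}"
  let ?L = "\<lambda>t. lattice_pairs P Q \<alpha> \<beta> t \<delta>"
  let ?f = "\<lambda>e (i, j). int Q * int i - int P * int j - e * int P * int Q"
  have "?K \<subseteq> ?f 0 ` ?L 0 \<union> ?f 1 ` ?L 1 \<union> ?f (-1) ` ?L (-1)"
  proof
    fix k assume k: "k \<in> ?K"
    obtain i j e where ije: "i < P" "j < Q" "int Q * int i - int P * int j - e * int P * int Q = k"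
      using ex_coprime_difference[OF P Q co] .
    have "\<bar>real_of_int k + \<theta>\<bar> \<le> \<delta> * P * Q" using k by auto
    then have *: "\<bar>(real i + \<alpha>) / real P - (real j + \<beta>) / real Q - e\<bar> \<le> \<delta>"
      using lattice_pairs_iff[OF P Q, of i \<alpha> j \<beta> e \<delta>] ije \<theta>_def by simp
    have "real i + 1 \<le> real P" "real j + 1 \<le> real Q" using ije by linarith+
    then have "(real i + \<alpha>) / P < 1" "(real j + \<beta>) / Q < 1" "(real i + \<alpha>) / P \<ge> 0" "(real j + \<beta>) / Q \<ge> 0"
      using ab by (auto simp: divide_simps)
    then have "\<bar>real_of_int e\<bar> < 2" using * d by linarith
    then have "e = 0 \<or> e = 1 \<or> e = -1" by linarith
    moreover have "(i, j) \<in> ?L (real_of_int e)" using ije * by (simp add: lattice_pairs_def)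
    moreover have "k = ?f e (i, j)" using ije by simp
    ultimately show "k \<in> ?f 0 ` ?L 0 \<union> ?f 1 ` ?L 1 \<union> ?f (-1) ` ?L (-1)"
      by (elim disjE) (auto simp del: prod.case intro!: image_eqI[where x = "(i, j)"])
  qed
  then have "card ?K \<le> card (?f 0 ` ?L 0 \<union> ?f 1 ` ?L 1 \<union> ?f (-1) ` ?L (-1))"
    by (intro card_mono) (simp_all add: finite_lattice_pairs)
  also have "\<dots> \<le> card (?f 0 ` ?L 0) + card (?f 1 ` ?L 1) + card (?f (-1) ` ?L (-1))"
    by (intro order_trans[OF card_Un_le] add_mono) auto
  also have "\<dots> \<le> card (?L 0) + card (?L 1) + card (?L (-1))"
    by (intro add_mono card_image_le finite_lattice_pairs)
  finally have "real (card ?K) \<le> card (?L 0) + card (?L 1) + card (?L (-1))"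
    by linarith
  moreover have "2 * \<delta> * P * Q - 1 \<le> real (card ?K)"
    using card_int_interval(1)[where A = "- \<theta> - \<delta> * P * Q" and B = "- \<theta> + \<delta> * P * Q"] by simp
  ultimately show ?thesis
    using card_lattice_pairs_1_le[OF P Q ab d(1)] card_lattice_pairs_m1_le[OF P Q ab d(1)] by linarith
qed


section \<open>Close pairs between the van der Corput sequences in bases 3 and 2\<close>

text \<open>Two separate lengths, since one is rounded to a multiple of a power of \<open>3\<close>
  and the other to a multiple of a power of \<open>2\<close>.\<close>

definition cross_count :: "nat \<Rightarrow> nat \<Rightarrow> real \<Rightarrow> real" where
  "cross_count M N \<delta> = (\<Sum>m<M. \<Sum>n<N. of_bool (\<bar>vdc 3 m - vdc 2 n\<bar> \<le> \<delta>))"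

lemma cross_count_mono:
  assumes "M \<le> M'" "N \<le> N'"
  shows "cross_count M N \<delta> \<le> cross_count M' N' \<delta>"
proof -
  have "cross_count M N \<delta> \<le> (\<Sum>m<M. \<Sum>n<N'. of_bool (\<bar>vdc 3 m - vdc 2 n\<bar> \<le> \<delta>))"
    unfolding cross_count_def using assms by (intro sum_mono sum_mono2) auto
  also have "\<dots> \<le> cross_count M' N' \<delta>"
    unfolding cross_count_def using assms by (intro sum_mono2 sum_nonneg) auto
  finally show ?thesis .
qed

lemma cross_count_blocks:
  "cross_count (J * 3 ^ a) (J' * 2 ^ b) \<delta> =
     (\<Sum>c<J. \<Sum>c'<J'. real (card (lattice_pairs (3 ^ a) (2 ^ b) (vdc 3 c) (vdc 2 c') 0 \<delta>)))"
proof -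
  have "cross_count (J * 3 ^ a) (J' * 2 ^ b) \<delta> =
    (\<Sum>c<J. \<Sum>i<3 ^ a. \<Sum>c'<J'. \<Sum>j<2 ^ b.
       of_bool (\<bar>(real i + vdc 3 c) / real (3 ^ a) - (real j + vdc 2 c') / real (2 ^ b)\<bar> \<le> \<delta>))"
    unfolding cross_count_def
    using sum_vdc_blocks[of 3 "\<lambda>x. \<Sum>n<J' * 2 ^ b. of_bool (\<bar>x - vdc 2 n\<bar> \<le> \<delta>)" J a]
      sum_vdc_blocks[of 2 "\<lambda>y. of_bool (\<bar>_ - y\<bar> \<le> \<delta>)" J' b] by simp
  also have "\<dots> = (\<Sum>c<J. \<Sum>c'<J'. \<Sum>i<3 ^ a. \<Sum>j<2 ^ b.
       of_bool (\<bar>(real i + vdc 3 c) / real (3 ^ a) - (real j + vdc 2 c') / real (2 ^ b)\<bar> \<le> \<delta>))"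
    by (intro sum.cong refl sum.swap)
  also have "\<dots> = (\<Sum>c<J. \<Sum>c'<J'. real (card (lattice_pairs (3 ^ a) (2 ^ b) (vdc 3 c) (vdc 2 c') 0 \<delta>)))"
  proof (intro sum.cong refl)
    fix c c'
    let ?R = "\<lambda>i j. \<bar>(real i + vdc 3 c) / real (3 ^ a) - (real j + vdc 2 c') / real (2 ^ b)\<bar> \<le> \<delta>"
    have "(\<Sum>i<3 ^ a. \<Sum>j<2 ^ b. of_bool (?R i j) :: real) =
       (\<Sum>(i, j)\<in>{..<3 ^ a} \<times> {..<2 ^ b}. of_bool (?R i j))"
      by (rule sum.cartesian_product)
    also have "\<dots> = (\<Sum>p\<in>{..<3 ^ a} \<times> {..<2 ^ b}. of_bool (case p of (i, j) \<Rightarrow> ?R i j))"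
      by (intro sum.cong) auto
    also have "\<dots> = real (card (({..<3 ^ a} \<times> {..<2 ^ b}) \<inter> {p. case p of (i, j) \<Rightarrow> ?R i j}))"
      by (subst sum_of_bool_eq) auto
    also have "({..<3 ^ a} \<times> {..<2 ^ b}) \<inter> {p. case p of (i, j) \<Rightarrow> ?R i j} =
        lattice_pairs (3 ^ a) (2 ^ b) (vdc 3 c) (vdc 2 c') 0 \<delta>"
      by (auto simp: lattice_pairs_def)
    finally show "(\<Sum>i<3 ^ a. \<Sum>j<2 ^ b. of_bool (?R i j) :: real) =
      real (card (lattice_pairs (3 ^ a) (2 ^ b) (vdc 3 c) (vdc 2 c') 0 \<delta>))" .
  qed
  finally show ?thesis .
qed

text \<open>Cuts \<open>N\<close> into at least \<open>c\<close> but fewer than \<open>c * b\<close>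
  full blocks, so that one block is at most a fraction \<open>1 / c\<close> of \<open>N\<close> and
  the number of blocks stays bounded.\<close>

lemma ex_power_block:
  fixes b c N :: nat
  assumes "2 \<le> b" "0 < c" "c \<le> N"
  obtains a where "c * b ^ a \<le> N" "N < c * b * b ^ a"
proof -
  have "1 \<le> N div c" using assms by (simp add: Suc_le_eq div_greater_zero_iff)
  then obtain a where "b ^ a \<le> N div c" "N div c < b ^ (a + 1)"
    using ex_power_ivl1[of b "N div c"] assms by auto
  then have "c * b ^ a \<le> N" "N < c * b * b ^ a"
    using assms by (simp_all add: less_eq_div_iff_mult_less_eq div_less_iff_less_mult ac_simps)
  then show ?thesis using that by blast
qed

text \<open>Rounding \<open>N\<close> up or down to full blocks costs a factor
  \<open>1 + 1 / c\<close> or \<open>1 - 1 / c\<close> in each variable. The remaining error is the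
  error per pair of blocks times the number of such pairs; for fixed \<open>c\<close> and bounded
  \<open>\<delta> * N\<close> it is bounded.\<close>

lemma cross_count_bounds:
  assumes c: "0 < c" "c \<le> N" and d: "0 \<le> \<delta>" "\<delta> < 1"
  shows "cross_count N N \<delta> \<le> 2 * \<delta> * (real N * (1 + 1 / c))\<^sup>2 + (3 * real c + 1)\<^sup>2"
    and "cross_count N N \<delta> \<ge> 2 * \<delta> * (real N * (1 - 1 / c))\<^sup>2 - (3 * real c)\<^sup>2 * (1 + 2 * (\<delta> * N + 2)\<^sup>2)"
proof -
  obtain a where a: "c * 3 ^ a \<le> N" "N < c * 3 * 3 ^ a" using ex_power_block[of 3 c N] c by auto
  obtain b where b: "c * 2 ^ b \<le> N" "N < c * 2 * 2 ^ b" using ex_power_block[of 2 c N] c by auto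
  define P :: nat where "P = 3 ^ a"
  define Q :: nat where "Q = 2 ^ b"
  define J where "J = N div P"
  define J' where "J' = N div Q"
  have P: "c * P \<le> N" "N < 3 * c * P" "0 < P" using a by (simp_all add: P_def)
  have Q: "c * Q \<le> N" "N < 2 * c * Q" "0 < Q" using b by (simp_all add: Q_def)
  have co: "coprime P Q" by (simp add: P_def Q_def coprime_power_left_iff coprime_power_right_iff)
  have J: "J * P \<le> N" "N < (J + 1) * P" "J < 3 * c"
    using P dividend_less_div_times[of P N]
    by (simp_all add: J_def div_less_iff_less_mult add.commute)
  have J': "J' * Q \<le> N" "N < (J' + 1) * Q" "J' < 2 * c"
    using Q dividend_less_div_times[of Q N]
    by (simp_all add: J'_def div_less_iff_less_mult add.commute)
  have "real c * P \<le> N" "real c * Q \<le> N"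
    using of_nat_mono[OF P(1), where ?'a = real] of_nat_mono[OF Q(1), where ?'a = real] by simp_all
  then have PN: "real P \<le> N / c" "real Q \<le> N / c" using c by (simp_all add: field_simps)
  have "P \<le> c * P" "Q \<le> c * Q" using c by simp_all
  then have PN': "P \<le> N" "Q \<le> N" using P(1) Q(1) by linarith+
  have v: "vdc 3 i \<in> {0..<1}" "vdc 2 i \<in> {0..<1}" for i using vdc_bounds by simp_all

  have JP: "real (J + 1) * P \<le> N * (1 + 1 / c)" "real (J' + 1) * Q \<le> N * (1 + 1 / c)"
  proof -
    have "real J * P \<le> N" "real J' * Q \<le> N" 
      using of_nat_mono[OF J(1), where ?'a = real] of_nat_mono[OF J'(1), where ?'a = real] by simp_all
    then show "real (J + 1) * P \<le> N * (1 + 1 / c)" "real (J' + 1) * Q \<le> N * (1 + 1 / c)"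
      using PN by (simp_all add: algebra_simps)
  qed
  \<comment> \<open>The block numbers are below \<open>3 * c\<close> and \<open>2 * c\<close>; for
    simplicity \<open>3 * c\<close> is used for both.\<close>
  have JJ: "real (J + 1) * real (J' + 1) \<le> (3 * real c + 1)\<^sup>2"
    unfolding power2_eq_square using J J' by (intro mult_mono) auto
  have "cross_count N N \<delta> \<le> cross_count ((J + 1) * P) ((J' + 1) * Q) \<delta>"
    using J J' by (intro cross_count_mono) auto
  also have "\<dots> = (\<Sum>i<J+1. \<Sum>j<J'+1. real (card (lattice_pairs P Q (vdc 3 i) (vdc 2 j) 0 \<delta>)))"
    unfolding P_def Q_def by (rule cross_count_blocks)
  also have "\<dots> \<le> (\<Sum>i<J+1. \<Sum>j<J'+1. 2 * \<delta> * P * Q + 1)"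
    using P Q co d by (intro sum_mono card_lattice_pairs_le) auto
  also have "\<dots> = 2 * \<delta> * ((real (J + 1) * P) * (real (J' + 1) * Q)) + real (J + 1) * real (J' + 1)"
    by (simp add: algebra_simps)
  also have "\<dots> \<le> 2 * \<delta> * (real N * (1 + 1 / c))\<^sup>2 + (3 * real c + 1)\<^sup>2"
    unfolding power2_eq_square[of "real N * _"]
    using d by (intro add_mono mult_left_mono mult_mono[OF JP] JJ) auto
  finally show "cross_count N N \<delta> \<le> 2 * \<delta> * (real N * (1 + 1 / c))\<^sup>2 + (3 * real c + 1)\<^sup>2" .

  have JP': "N * (1 - 1 / c) \<le> real J * P" "N * (1 - 1 / c) \<le> real J' * Q"
  proof -
    have "real N \<le> (real J + 1) * P" "real N \<le> (real J' + 1) * Q"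
      using of_nat_mono[OF less_imp_le[OF J(2)], where ?'a = real]
        of_nat_mono[OF less_imp_le[OF J'(2)], where ?'a = real]
      by (simp_all add: algebra_simps)
    then show "N * (1 - 1 / c) \<le> real J * P" "N * (1 - 1 / c) \<le> real J' * Q"
      using PN by (simp_all add: algebra_simps)
  qed
  have JJ': "real J * real J' \<le> (3 * real c)\<^sup>2"
    unfolding power2_eq_square using J J' by (intro mult_mono) auto
  \<comment> \<open>Multiplying the two lower bounds \<open>JP'\<close> requires nonnegative left
    sides.\<close>
  have nn: "0 \<le> real N * (1 - 1 / c)" using c by (simp add: field_simps)
  have err: "1 + 2 * (\<delta> * P + 2) * (\<delta> * Q + 2) \<le> 1 + 2 * (\<delta> * N + 2)\<^sup>2"
    unfolding power2_eq_square mult.assoc using d PN'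
    by (intro add_mono mult_left_mono mult_mono) (auto intro!: add_nonneg_nonneg mult_nonneg_nonneg)
  have "real J * real J' * (1 + 2 * (\<delta> * P + 2) * (\<delta> * Q + 2)) \<le> (3 * real c)\<^sup>2 * (1 + 2 * (\<delta> * N + 2)\<^sup>2)"
    using err JJ' d by (intro mult_mono) auto
  moreover have "2 * \<delta> * (real N * (1 - 1 / c))\<^sup>2 \<le> 2 * \<delta> * ((real J * P) * (real J' * Q))"
    unfolding power2_eq_square[of "real N * _"]
    using d nn by (intro mult_left_mono mult_mono[OF JP']) auto
  ultimately have "2 * \<delta> * (real N * (1 - 1 / c))\<^sup>2 - (3 * real c)\<^sup>2 * (1 + 2 * (\<delta> * N + 2)\<^sup>2)
     \<le> 2 * \<delta> * ((real J * P) * (real J' * Q)) - real J * real J' * (1 + 2 * (\<delta> * P + 2) * (\<delta> * Q + 2))"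
    by linarith
  also have "\<dots> = (\<Sum>i<J. \<Sum>j<J'. 2 * \<delta> * P * Q - 1 - 2 * (\<delta> * P + 2) * (\<delta> * Q + 2))"
    by (simp add: algebra_simps)
  also have "\<dots> \<le> (\<Sum>i<J. \<Sum>j<J'. real (card (lattice_pairs P Q (vdc 3 i) (vdc 2 j) 0 \<delta>)))"
    using P Q co d v by (intro sum_mono card_lattice_pairs_ge) auto
  also have "\<dots> = cross_count (J * P) (J' * Q) \<delta>"
    unfolding P_def Q_def by (rule cross_count_blocks[symmetric])
  also have "\<dots> \<le> cross_count N N \<delta>"
    using J J' by (intro cross_count_mono) auto
  finally show "cross_count N N \<delta> \<ge> 2 * \<delta> * (real N * (1 - 1 / c))\<^sup>2 - (3 * real c)\<^sup>2 * (1 + 2 * (\<delta> * N + 2)\<^sup>2)" .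
qed


text \<open>The block parameter \<open>c\<close> is fixed first, close enough to the limit
  \<open>c \<rightarrow> \<infinity>\<close>; then \<open>K\<close> grows and the bounded errors
  vanish after division by \<open>n K\<close>.\<close>

lemma cross_count_tendsto:
  assumes n: "filterlim n at_top sequentially"
    and lim: "(\<lambda>K. \<delta> K * real (n K)) \<longlonglongrightarrow> t"
    and pos: "\<And>K. 0 \<le> \<delta> K"
  shows "(\<lambda>K. cross_count (n K) (n K) (\<delta> K) / real (n K)) \<longlonglongrightarrow> 2 * t"
proof -
  have rn: "filterlim (\<lambda>K. real (n K)) at_top sequentially"
    using filterlim_compose[OF filterlim_real_sequentially n] .
  have inv: "(\<lambda>K. C / real (n K)) \<longlonglongrightarrow> 0" for C
    by (rule real_tendsto_divide_at_top[OF tendsto_const rn])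
  \<comment> \<open>Convergence of \<open>\<delta> K * n K\<close> forces \<open>\<delta> K\<close>
    to tend to \<open>0\<close>, hence eventually below \<open>1\<close>, as the block bounds
    demand.\<close>
  have "(\<lambda>K. (\<delta> K * real (n K)) * (1 / real (n K))) \<longlonglongrightarrow> t * 0"
    by (intro tendsto_mult lim inv)
  moreover have n0: "eventually (\<lambda>K. 0 < n K) sequentially"
    using n[unfolded filterlim_at_top, THEN spec, of 1] by (simp add: Suc_le_eq)
  then have "eventually (\<lambda>K. (\<delta> K * real (n K)) * (1 / real (n K)) = \<delta> K) sequentially"
    by eventually_elim simp
  ultimately have "\<delta> \<longlonglongrightarrow> t * 0" by (rule Lim_transform_eventually)
  then have d1: "eventually (\<lambda>K. \<delta> K < 1) sequentially" by (rule order_tendstoD) simp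
  have nc: "eventually (\<lambda>K. c \<le> n K) sequentially" for c
    using n by (simp add: filterlim_at_top)
  have inv_c: "(\<lambda>c. 1 / real c) \<longlonglongrightarrow> 0" by (rule lim_1_over_n)
  show ?thesis
  proof (rule order_tendstoI)
    fix a assume a: "2 * t < a"
    have "(\<lambda>c. 2 * t * (1 + 1 / real c)\<^sup>2) \<longlonglongrightarrow> 2 * t * (1 + 0)\<^sup>2"
      by (intro tendsto_intros inv_c)
    then have "eventually (\<lambda>c. 2 * t * (1 + 1 / real c)\<^sup>2 < a) sequentially"
      by (rule order_tendstoD) (use a in simp)
    then have "eventually (\<lambda>c. 2 * t * (1 + 1 / real c)\<^sup>2 < a \<and> 0 < c) sequentially"
      using eventually_gt_at_top by (rule eventually_conj)
    then obtain c where c: "2 * t * (1 + 1 / real c)\<^sup>2 < a" "0 < c"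
      by (auto dest: eventually_happens)
    have "(\<lambda>K. 2 * (\<delta> K * real (n K)) * (1 + 1 / real c)\<^sup>2 + (3 * real c + 1)\<^sup>2 / real (n K))
        \<longlonglongrightarrow> 2 * t * (1 + 1 / real c)\<^sup>2 + 0"
      by (intro tendsto_intros lim inv)
    then have "eventually (\<lambda>K. 2 * (\<delta> K * real (n K)) * (1 + 1 / real c)\<^sup>2
        + (3 * real c + 1)\<^sup>2 / real (n K) < a) sequentially"
      by (rule order_tendstoD) (use c in simp)
    then show "eventually (\<lambda>K. cross_count (n K) (n K) (\<delta> K) / real (n K) < a) sequentially"
      using nc[of c] d1 n0
    proof eventually_elim
      case (elim K)
      have "cross_count (n K) (n K) (\<delta> K) / real (n K) \<le>
          (2 * \<delta> K * (real (n K) * (1 + 1 / c))\<^sup>2 + (3 * real c + 1)\<^sup>2) / real (n K)"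
        using elim c pos by (intro divide_right_mono cross_count_bounds) auto
      also have "\<dots> = 2 * (\<delta> K * real (n K)) * (1 + 1 / real c)\<^sup>2 + (3 * real c + 1)\<^sup>2 / real (n K)"
        using elim by (simp add: add_divide_distrib power_mult_distrib power2_eq_square[of "real _"])
      finally show ?case using elim by linarith
    qed
  next
    fix a assume a: "a < 2 * t"
    have "(\<lambda>c. 2 * t * (1 - 1 / real c)\<^sup>2) \<longlonglongrightarrow> 2 * t * (1 - 0)\<^sup>2"
      by (intro tendsto_intros inv_c)
    then have "eventually (\<lambda>c. a < 2 * t * (1 - 1 / real c)\<^sup>2) sequentially"
      by (rule order_tendstoD) (use a in simp)
    then have "eventually (\<lambda>c. a < 2 * t * (1 - 1 / real c)\<^sup>2 \<and> 0 < c) sequentially"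
      using eventually_gt_at_top by (rule eventually_conj)
    then obtain c where c: "a < 2 * t * (1 - 1 / real c)\<^sup>2" "0 < c"
      by (auto dest: eventually_happens)
    have "(\<lambda>K. 2 * (\<delta> K * real (n K)) * (1 - 1 / real c)\<^sup>2
          - (3 * real c)\<^sup>2 * (1 + 2 * (\<delta> K * real (n K) + 2)\<^sup>2) * (1 / real (n K)))
        \<longlonglongrightarrow> 2 * t * (1 - 1 / real c)\<^sup>2 - (3 * real c)\<^sup>2 * (1 + 2 * (t + 2)\<^sup>2) * 0"
      by (intro tendsto_intros lim inv)
    then have "eventually (\<lambda>K. a < 2 * (\<delta> K * real (n K)) * (1 - 1 / real c)\<^sup>2
          - (3 * real c)\<^sup>2 * (1 + 2 * (\<delta> K * real (n K) + 2)\<^sup>2) * (1 / real (n K))) sequentially"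
      by (rule order_tendstoD) (use c in simp)
    then show "eventually (\<lambda>K. a < cross_count (n K) (n K) (\<delta> K) / real (n K)) sequentially"
      using nc[of c] d1 n0
    proof eventually_elim
      case (elim K)
      have "2 * (\<delta> K * real (n K)) * (1 - 1 / real c)\<^sup>2
          - (3 * real c)\<^sup>2 * (1 + 2 * (\<delta> K * real (n K) + 2)\<^sup>2) * (1 / real (n K)) =
          (2 * \<delta> K * (real (n K) * (1 - 1 / c))\<^sup>2
            - (3 * real c)\<^sup>2 * (1 + 2 * (\<delta> K * real (n K) + 2)\<^sup>2)) / real (n K)"
        using elim by (simp add: diff_divide_distrib power_mult_distrib power2_eq_square[of "real _"])
      also have "\<dots> \<le> cross_count (n K) (n K) (\<delta> K) / real (n K)"
        using elim c pos by (intro divide_right_mono cross_count_bounds) auto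
      finally show ?case using elim by linarith
    qed
  qed
qed

section \<open>Distance to the nearest integer and pair counts\<close>

lemma nearest_int_dist_greatest:
  "(\<And>k::int. c \<le> \<bar>x - of_int k\<bar>) \<Longrightarrow> c \<le> nearest_int_dist x"
  using nearest_int_dist_attained[of x] by auto

lemma nearest_int_dist_diff_ge: "nearest_int_dist x - \<bar>d\<bar> \<le> nearest_int_dist (x + d)"
proof (rule nearest_int_dist_greatest)
  fix k :: int
  show "nearest_int_dist x - \<bar>d\<bar> \<le> \<bar>x + d - of_int k\<bar>"
    using nearest_int_dist_le[of x k] by linarith
qed

lemma nearest_int_dist_small:
  assumes "\<bar>x\<bar> \<le> 1 / 2"
  shows "nearest_int_dist x = \<bar>x\<bar>"
proof (rule antisym)
  show "nearest_int_dist x \<le> \<bar>x\<bar>" using nearest_int_dist_le[of x 0] by simp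
  show "\<bar>x\<bar> \<le> nearest_int_dist x"
  proof (rule nearest_int_dist_greatest)
    fix k :: int
    have "k = 0 \<or> 1 \<le> \<bar>real_of_int k\<bar>" by linarith
    then show "\<bar>x\<bar> \<le> \<bar>x - of_int k\<bar>" using assms by auto
  qed
qed

text \<open>Serves the case \<open>\<gamma> = 1 / 2\<close>, where reversed cross differences,
  reduced by \<open>\<gamma>\<close>, lie near \<open>-1\<close>.\<close>

lemma nearest_int_dist_minus_1: "nearest_int_dist (x - 1) = nearest_int_dist x"
proof (rule antisym)
  show "nearest_int_dist (x - 1) \<le> nearest_int_dist x"
    using nearest_int_dist_le[of "x - 1" "_ - 1"] by (intro nearest_int_dist_greatest) fastforce
  show "nearest_int_dist x \<le> nearest_int_dist (x - 1)"
    using nearest_int_dist_le[of x "_ + 1"] by (intro nearest_int_dist_greatest) (fastforce simp: algebra_simps)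
qed

text \<open>The radius is decoupled from \<open>N\<close>: with the radius held fixed, the count is
  monotone in \<open>N\<close>, unlike \<open>R2\<close>.\<close>

definition pair_count :: "(nat \<Rightarrow> real) \<Rightarrow> real \<Rightarrow> real \<Rightarrow> nat \<Rightarrow> nat" where
  "pair_count x \<gamma> \<epsilon> N = card {(m, n). m \<in> {1..N} \<and> n \<in> {1..N} \<and> m \<noteq> n \<and>
                   nearest_int_dist (x m - x n - \<gamma>) \<le> \<epsilon>}"

lemma R2_eq_pair_count: "R2 x \<gamma> s N = real (pair_count x \<gamma> (s / real N) N) / real N"
  by (simp add: R2_def pair_count_def)

lemma pair_count_mono: "M \<le> N \<Longrightarrow> pair_count x \<gamma> \<epsilon> M \<le> pair_count x \<gamma> \<epsilon> N"
  unfolding pair_count_def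
  by (intro card_mono) (auto intro: finite_subset[of _ "{1..N} \<times> {1..N}"])

lemma pair_count_eq_sum:
  assumes "\<epsilon> < nearest_int_dist (- \<gamma>)"
  shows "real (pair_count x \<gamma> \<epsilon> N) =
    (\<Sum>i<N. \<Sum>j<N. of_bool (nearest_int_dist (x (Suc i) - x (Suc j) - \<gamma>) \<le> \<epsilon>))"
proof -
  let ?R = "\<lambda>p. case p of (m, n) \<Rightarrow> nearest_int_dist (x m - x n - \<gamma>) \<le> \<epsilon>"
  have "{(m, n). m \<in> {1..N} \<and> n \<in> {1..N} \<and> m \<noteq> n \<and> nearest_int_dist (x m - x n - \<gamma>) \<le> \<epsilon>}
      = ({1..N} \<times> {1..N}) \<inter> {p. ?R p}"
    using assms by auto
  then have "real (pair_count x \<gamma> \<epsilon> N) = (\<Sum>p\<in>{1..N} \<times> {1..N}. of_bool (?R p))"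
    unfolding pair_count_def by (subst sum_of_bool_eq) auto
  also have "\<dots> = (\<Sum>(m, n)\<in>{1..N} \<times> {1..N}. of_bool (nearest_int_dist (x m - x n - \<gamma>) \<le> \<epsilon>))"
    by (intro sum.cong) auto
  also have "\<dots> = (\<Sum>m\<in>{1..N}. \<Sum>n\<in>{1..N}. of_bool (nearest_int_dist (x m - x n - \<gamma>) \<le> \<epsilon>))"
    by (rule sum.cartesian_product[symmetric])
  also have "\<dots> = (\<Sum>i<N. \<Sum>j<N. of_bool (nearest_int_dist (x (Suc i) - x (Suc j) - \<gamma>) \<le> \<epsilon>))"
    by (simp add: sum.atLeast1_atMost_eq)
  finally show ?thesis .
qed

section \<open>The two-cluster sequence and its pair correlations\<close>

text \<open>Since indices start at \<open>1\<close>, group \<open>k\<close> begins at index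
  \<open>k * q + 1\<close>, with its point near \<open>\<gamma>\<close>.\<close>

definition two_cluster :: "real \<Rightarrow> real \<Rightarrow> nat \<Rightarrow> nat \<Rightarrow> real" where
  "two_cluster \<gamma> L q n =
     (let k = (n - 1) div q in if (n - 1) mod q = 0 then \<gamma> + L * vdc 3 k else L * vdc 2 k)"

lemma sum_two_cluster:
  fixes f :: "real \<Rightarrow> real"
  assumes "0 < q"
  shows "(\<Sum>i<N * q. f (two_cluster \<gamma> L q (Suc i))) =
    (\<Sum>k<N. f (\<gamma> + L * vdc 3 k) + (real q - 1) * f (L * vdc 2 k))"
proof -
  obtain q' where q': "q = Suc q'" using assms gr0_implies_Suc by blast
  have *: "(k * q + r) div q = k" "(k * q + r) mod q = r" if "r < q" for k r
    using that by simp_all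
  have "(\<Sum>r<q. f (two_cluster \<gamma> L q (Suc (k * q + r)))) =
      (\<Sum>r<q. f (if r = 0 then \<gamma> + L * vdc 3 k else L * vdc 2 k))" for k
    by (intro sum.cong refl) (simp add: two_cluster_def Let_def * del: div_mult_self3 mod_mult_self3)
  also have "\<dots> k = f (\<gamma> + L * vdc 3 k) + (real q - 1) * f (L * vdc 2 k)" for k
    unfolding q' sum.lessThan_Suc_shift by simp
  finally show ?thesis by (simp add: sum_nat_group_offset)
qed

text \<open>Within a cluster, differences minus \<open>\<gamma>\<close> are near
  \<open>- \<gamma>\<close>; reversed cross differences are near \<open>- (2 * \<gamma>)\<close>.
  Perturbations below \<open>\<eta> / 2\<close> keep both farther than \<open>\<epsilon>\<close>
  from the integers unless \<open>\<gamma> = 1 / 2\<close>. The factor \<open>q - 1\<close> counts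
  the copies.\<close>

lemma pair_count_two_cluster:
  assumes q: "0 < q" and L: "0 < L" "L < \<eta> / 2" and eps: "\<epsilon> < \<eta> / 2"
    and eta: "\<eta> \<le> 1 / 2" "\<eta> \<le> nearest_int_dist (- \<gamma>)"
      "\<gamma> \<noteq> 1 / 2 \<Longrightarrow> \<eta> \<le> nearest_int_dist (- (2 * \<gamma>))"
  shows "real (pair_count (two_cluster \<gamma> L q) \<gamma> \<epsilon> (N * q)) =
    (if \<gamma> = 1 / 2 then 2 else 1) * (real q - 1) * cross_count N N (\<epsilon> / L)"
proof -
  let ?g = "\<lambda>a b. of_bool (nearest_int_dist (a - b - \<gamma>) \<le> \<epsilon>) :: real"
  let ?z = "\<lambda>k. \<gamma> + L * vdc 3 k" and ?y = "\<lambda>k. L * vdc 2 k"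
  have small: "\<bar>L * (vdc b k - vdc b' l)\<bar> < \<eta> / 2" if "b \<in> {2, 3}" "b' \<in> {2, 3}" for b b' k l
  proof -
    have "\<bar>vdc b k - vdc b' l\<bar> \<le> 1" using vdc_bounds[of b k] vdc_bounds[of b' l] that by auto
    then have "L * \<bar>vdc b k - vdc b' l\<bar> \<le> L" using L by (simp add: mult_left_le)
    then have "\<bar>L * (vdc b k - vdc b' l)\<bar> \<le> L" using L by (simp add: abs_mult)
    then show ?thesis using L by linarith
  qed
  have far: "\<epsilon> < nearest_int_dist (c + d)" if "\<eta> \<le> nearest_int_dist c" "\<bar>d\<bar> < \<eta> / 2" for c d
    using nearest_int_dist_diff_ge[of c d] that eps by linarith
  have zz: "?g (?z k) (?z l) = 0" for k l
    using far[OF eta(2) small[of 3 3 k l]] by (simp add: algebra_simps)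
  have yy: "?g (?y k) (?y l) = 0" for k l
    using far[OF eta(2) small[of 2 2 k l]] by (simp add: algebra_simps)
  \<comment> \<open>Below \<open>1 / 2\<close> the nearest integer is \<open>0\<close>, so the scale
    \<open>L\<close> can be divided out.\<close>
  have near: "nearest_int_dist (L * (vdc b k - vdc b' l)) \<le> \<epsilon> \<longleftrightarrow> \<bar>vdc b k - vdc b' l\<bar> \<le> \<epsilon> / L"
    if "b \<in> {2, 3}" "b' \<in> {2, 3}" for b b' k l
  proof -
    have "nearest_int_dist (L * (vdc b k - vdc b' l)) = \<bar>L * (vdc b k - vdc b' l)\<bar>"
      using small[OF that, of k l] eta(1) by (intro nearest_int_dist_small) linarith
    also have "\<dots> = \<bar>vdc b k - vdc b' l\<bar> * L" using L by (simp add: abs_mult)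
    finally show ?thesis using L by (simp add: pos_le_divide_eq)
  qed
  have zy: "?g (?z k) (?y l) = of_bool (\<bar>vdc 3 k - vdc 2 l\<bar> \<le> \<epsilon> / L)" for k l
    using near[of 3 2 k l] by (simp add: algebra_simps)
  have yz: "?g (?y k) (?z l) = (if \<gamma> = 1 / 2 then of_bool (\<bar>vdc 3 l - vdc 2 k\<bar> \<le> \<epsilon> / L) else 0)" for k l
  proof (cases "\<gamma> = 1 / 2")
    case True
    then have "?y k - ?z l - \<gamma> = L * (vdc 2 k - vdc 3 l) - 1" by (simp add: algebra_simps)
    then have "nearest_int_dist (?y k - ?z l - \<gamma>) = nearest_int_dist (L * (vdc 2 k - vdc 3 l))"
      by (simp only: nearest_int_dist_minus_1)
    then show ?thesis using True near[of 2 3 k l] by (simp only: if_True) (simp add: abs_minus_commute)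
  next
    case False
    then show ?thesis using far[OF eta(3) small[of 2 3 k l]] by (simp add: algebra_simps)
  qed
  have "real (pair_count (two_cluster \<gamma> L q) \<gamma> \<epsilon> (N * q)) =
    (\<Sum>i<N * q. \<Sum>j<N * q. ?g (two_cluster \<gamma> L q (Suc i)) (two_cluster \<gamma> L q (Suc j)))"
    using eps eta L by (intro pair_count_eq_sum) auto
  also have "\<dots> = (\<Sum>i<N * q. \<Sum>l<N. ?g (two_cluster \<gamma> L q (Suc i)) (?z l)
      + (real q - 1) * ?g (two_cluster \<gamma> L q (Suc i)) (?y l))"
    by (intro sum.cong refl sum_two_cluster[OF q])
  also have "\<dots> = (\<Sum>k<N. (\<Sum>l<N. ?g (?z k) (?z l) + (real q - 1) * ?g (?z k) (?y l))
      + (real q - 1) * (\<Sum>l<N. ?g (?y k) (?z l) + (real q - 1) * ?g (?y k) (?y l)))"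
    by (rule sum_two_cluster[OF q])
  also have "\<dots> = (real q - 1) * ((\<Sum>k<N. \<Sum>l<N. ?g (?z k) (?y l)) + (\<Sum>k<N. \<Sum>l<N. ?g (?y k) (?z l)))"
    by (simp only: zz yy mult_zero_right add_0_left add_0_right sum.distrib distrib_left sum_distrib_left)
  also have "(\<Sum>k<N. \<Sum>l<N. ?g (?z k) (?y l)) = cross_count N N (\<epsilon> / L)"
    unfolding zy cross_count_def ..
  also have "(\<Sum>k<N. \<Sum>l<N. ?g (?y k) (?z l)) = (if \<gamma> = 1 / 2 then cross_count N N (\<epsilon> / L) else 0)"
    unfolding yz cross_count_def by (subst sum.swap) simp
  finally show ?thesis by simp
qed

lemma nearest_int_dist_pos:
  assumes "\<And>k::int. x \<noteq> of_int k"
  shows "0 < nearest_int_dist x"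
  using nearest_int_dist_attained[of x] assms by auto

text \<open>With about \<open>K / q\<close> groups and rescaled radius \<open>s / (K * L)\<close>
  there are about \<open>\<kappa> * 2 * s / (K * L) * (K / q)\<^sup>2\<close> pairs, where
  \<open>\<kappa>\<close> is the numerator in \<open>norm\<close>; this is \<open>2 * s * K\<close>
  exactly when \<open>L = \<kappa> / q\<^sup>2\<close>.\<close>

lemma two_cluster_has_PPC:
  assumes q: "0 < q" and L: "0 < L" "L < \<eta> / 2"
    and eta: "\<eta> \<le> 1 / 2" "\<eta> \<le> nearest_int_dist (- \<gamma>)"
      "\<gamma> \<noteq> 1 / 2 \<Longrightarrow> \<eta> \<le> nearest_int_dist (- (2 * \<gamma>))"
    and norm: "L = (if \<gamma> = 1 / 2 then 2 else 1) * (real q - 1) / (real q)\<^sup>2"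
  shows "has_PPC \<gamma> (two_cluster \<gamma> L q)"
  unfolding has_PPC_def
proof (intro allI impI)
  fix s :: real assume s: "0 < s"
  define \<kappa> :: real where "\<kappa> = (if \<gamma> = 1 / 2 then 2 else 1) * (real q - 1)"
  let ?x = "two_cluster \<gamma> L q"
  \<comment> \<open>The threshold concerns the radius alone, so the formula holds for all
    \<open>N\<close> at once, in particular for \<open>K div q\<close> and its successor.\<close>
  have cc: "eventually (\<lambda>K. \<forall>N. real (pair_count ?x \<gamma> (s / real K) (N * q)) =
      \<kappa> * cross_count N N (s / real K / L)) sequentially"
  proof -
    have "(\<lambda>K. s / real K) \<longlonglongrightarrow> 0" by (rule lim_const_over_n)
    then have "eventually (\<lambda>K. s / real K < \<eta> / 2) sequentially"
      by (rule order_tendstoD) (use L in simp)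
    then show ?thesis
      by eventually_elim (use pair_count_two_cluster[OF q L _ eta] \<kappa>_def in auto)
  qed
  have ratio: "(\<lambda>K. real (K div q) / real K) \<longlonglongrightarrow> 1 / q"
  proof (rule tendsto_sandwich)
    show "(\<lambda>K. 1 / q - 1 / real K) \<longlonglongrightarrow> 1 / q"
      using tendsto_diff[OF tendsto_const lim_1_over_n, of "1 / real q"] by simp
    show "eventually (\<lambda>K. 1 / q - 1 / real K \<le> real (K div q) / real K) sequentially"
      using eventually_gt_at_top[of 0]
    proof eventually_elim
      case (elim K)
      have "real K / q - 1 \<le> real (K div q)"
        using floor_divide_of_nat_eq[of K q, where ?'a = real] by linarith
      then have "(real K / q - 1) / real K \<le> real (K div q) / real K"
        by (rule divide_right_mono) simp
      then show ?case using elim by (simp add: diff_divide_distrib)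
    qed
    show "eventually (\<lambda>K. real (K div q) / real K \<le> 1 / q) sequentially"
      using eventually_gt_at_top[of 0]
    proof eventually_elim
      case (elim K)
      have "real (K div q) / real K \<le> (real K / q) / real K"
        by (intro divide_right_mono of_nat_div_le_of_nat) simp
      then show ?case using elim by simp
    qed
  qed simp
  \<comment> \<open>The number of groups is left general to cover rounding \<open>K\<close> both
    down and up to full groups.\<close>
  have lim: "(\<lambda>K. \<kappa> * cross_count (n K) (n K) (s / real K / L) / real K) \<longlonglongrightarrow> 2 * s"
    if n: "filterlim n at_top sequentially" and r: "(\<lambda>K. real (n K) / real K) \<longlonglongrightarrow> 1 / q" for n
  proof -
    have "(\<lambda>K. s / real K / L * real (n K)) \<longlonglongrightarrow> s / L * (1 / q)"
      using tendsto_mult[OF tendsto_const r, of "s / L"] by (simp add: field_simps)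
    then have "(\<lambda>K. cross_count (n K) (n K) (s / real K / L) / real (n K)) \<longlonglongrightarrow> 2 * (s / L * (1 / q))"
      using s L by (intro cross_count_tendsto n) auto
    then have "(\<lambda>K. \<kappa> * (cross_count (n K) (n K) (s / real K / L) / real (n K) * (real (n K) / real K)))
        \<longlonglongrightarrow> \<kappa> * (2 * (s / L * (1 / q)) * (1 / q))"
      by (intro tendsto_intros r)
    moreover have "\<kappa> * (2 * (s / L * (1 / q)) * (1 / q)) = 2 * s"
    proof -
      have "\<kappa> = L * (real q)\<^sup>2" using norm q unfolding \<kappa>_def by (simp add: field_simps)
      then show ?thesis using L q by (simp add: power2_eq_square)
    qed
    ultimately have "(\<lambda>K. \<kappa> * (cross_count (n K) (n K) (s / real K / L) / real (n K) * (real (n K) / real K)))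
        \<longlonglongrightarrow> 2 * s"
      by (simp only:)
    moreover have "eventually (\<lambda>K. 0 < n K) sequentially"
      using n[unfolded filterlim_at_top, THEN spec, of 1] by (simp add: Suc_le_eq)
    then have "eventually (\<lambda>K. \<kappa> * (cross_count (n K) (n K) (s / real K / L) / real (n K) * (real (n K) / real K))
        = \<kappa> * cross_count (n K) (n K) (s / real K / L) / real K) sequentially"
      by eventually_elim simp
    ultimately show ?thesis by (rule Lim_transform_eventually)
  qed
  have top: "filterlim (\<lambda>K. K div q) at_top sequentially"
    unfolding filterlim_at_top
  proof
    fix Z :: nat
    show "eventually (\<lambda>K. Z \<le> K div q) sequentially"
      using eventually_ge_at_top[of "Z * q"]
      by eventually_elim (use q in \<open>simp add: less_eq_div_iff_mult_less_eq\<close>)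
  qed
  show "(\<lambda>K. R2 ?x \<gamma> s K) \<longlonglongrightarrow> 2 * s"
  proof (rule tendsto_sandwich)
    show "(\<lambda>K. \<kappa> * cross_count (K div q) (K div q) (s / real K / L) / real K) \<longlonglongrightarrow> 2 * s"
      by (rule lim[OF top ratio])
    have "(\<lambda>K. real (K div q) / real K + 1 / real K) \<longlonglongrightarrow> 1 / q + 0"
      by (intro tendsto_add ratio lim_1_over_n)
    then have "(\<lambda>K. real (Suc (K div q)) / real K) \<longlonglongrightarrow> 1 / q"
      by (simp add: add_divide_distrib add.commute)
    then show "(\<lambda>K. \<kappa> * cross_count (Suc (K div q)) (Suc (K div q)) (s / real K / L) / real K) \<longlonglongrightarrow> 2 * s"
      by (intro lim filterlim_compose[OF filterlim_Suc top])
    show "eventually (\<lambda>K. \<kappa> * cross_count (K div q) (K div q) (s / real K / L) / real K \<le> R2 ?x \<gamma> s K) sequentially"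
      using cc
    proof eventually_elim
      case (elim K)
      have "pair_count ?x \<gamma> (s / real K) (K div q * q) \<le> pair_count ?x \<gamma> (s / real K) K"
        by (rule pair_count_mono) simp
      then have "\<kappa> * cross_count (K div q) (K div q) (s / real K / L) \<le> real (pair_count ?x \<gamma> (s / real K) K)"
        using elim[rule_format, of "K div q"] by linarith
      then show ?case unfolding R2_eq_pair_count by (rule divide_right_mono) simp
    qed
    show "eventually (\<lambda>K. R2 ?x \<gamma> s K \<le> \<kappa> * cross_count (Suc (K div q)) (Suc (K div q)) (s / real K / L) / real K) sequentially"
      using cc
    proof eventually_elim
      case (elim K)
      have "pair_count ?x \<gamma> (s / real K) K \<le> pair_count ?x \<gamma> (s / real K) (Suc (K div q) * q)"
        using dividend_less_div_times[OF q, of K] by (intro pair_count_mono) simp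
      then have "real (pair_count ?x \<gamma> (s / real K) K) \<le>
          \<kappa> * cross_count (Suc (K div q)) (Suc (K div q)) (s / real K / L)"
        using elim[rule_format, of "Suc (K div q)"] by linarith
      then show ?case unfolding R2_eq_pair_count by (rule divide_right_mono) simp
    qed
  qed
qed

section \<open>Choice of the parameters and the gap\<close>

theorem theorem1:
  fixes \<gamma> :: real
  assumes "0 < \<gamma>" and "\<gamma> < 1"
  shows "\<exists>x :: nat \<Rightarrow> real.
           (\<forall>n\<ge>1. x n \<in> {0..1}) \<and> has_PPC \<gamma> x \<and> \<not> uniformly_distributed_mod1 x"
proof -
  \<comment> \<open>The entries \<open>\<gamma>\<close> and \<open>1 - \<gamma>\<close> keep the
    lower cluster below \<open>\<gamma> / 2\<close> and the upper one below \<open>1\<close>. For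
    \<open>\<gamma> = 1 / 2\<close> the last distance would be \<open>0\<close>, so the harmless
    value \<open>1\<close> replaces it.\<close>
  define \<eta> where "\<eta> = Min {1 / 2, \<gamma>, 1 - \<gamma>, nearest_int_dist (- \<gamma>),
    if \<gamma> = 1 / 2 then 1 else nearest_int_dist (- (2 * \<gamma>))}"
  have eta: "\<eta> \<le> 1 / 2" "\<eta> \<le> nearest_int_dist (- \<gamma>)"
      "\<gamma> \<noteq> 1 / 2 \<Longrightarrow> \<eta> \<le> nearest_int_dist (- (2 * \<gamma>))" "\<eta> \<le> \<gamma>" "\<eta> \<le> 1 - \<gamma>"
    unfolding \<eta>_def by (rule Min_le; simp)+
  have "- \<gamma> \<noteq> of_int k" for k :: int
  proof
    assume "- \<gamma> = of_int k"
    then have "- 1 < k" "k < 0" using assms by linarith+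
    then show False by linarith
  qed
  moreover have "- (2 * \<gamma>) \<noteq> of_int k" if "\<gamma> \<noteq> 1 / 2" for k :: int
  proof
    assume k: "- (2 * \<gamma>) = of_int k"
    then have "- 2 < k" "k < 0" using assms by linarith+
    then have "k = - 1" by linarith
    then show False using k that by simp
  qed
  ultimately have pos: "0 < \<eta>"
    unfolding \<eta>_def using assms nearest_int_dist_pos by auto
  define \<kappa> :: real where "\<kappa> = (if \<gamma> = 1 / 2 then 2 else 1)"
  define len where "len q = \<kappa> * (real q - 1) / (real q)\<^sup>2" for q :: nat
  \<comment> \<open>Since \<open>len q \<le> 2 / q\<close>, the bound \<open>4 / \<eta> < q\<close>
    makes the clusters shorter than \<open>\<eta> / 2\<close>.\<close>
  obtain q :: nat where q: "4 / \<eta> < real q" using reals_Archimedean2 by blast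
  have "4 / \<eta> \<ge> 8" using pos eta(1) by (simp add: field_simps)
  then have q2: "8 < real q" using q by linarith
  have L0: "0 < len q" using q2 by (simp add: len_def \<kappa>_def)
  have "len q \<le> 2 * real q / (real q)\<^sup>2"
    unfolding len_def using q2 by (intro divide_right_mono mult_mono) (auto simp: \<kappa>_def)
  also have "\<dots> = 2 / real q" using q2 by (simp add: power2_eq_square)
  also have "\<dots> < \<eta> / 2" using q pos q2 by (simp add: field_simps)
  finally have L1: "len q < \<eta> / 2" .
  define x where "x = two_cluster \<gamma> (len q) q"
  have Lv: "0 \<le> len q * vdc b k" "len q * vdc b k < \<eta> / 2" if "2 \<le> b" for b k
  proof -
    show "0 \<le> len q * vdc b k" using L0 vdc_bounds[OF that, of k] by simp
    have "len q * vdc b k \<le> len q" using L0 vdc_bounds[OF that, of k] by (simp add: mult_left_le)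
    then show "len q * vdc b k < \<eta> / 2" using L1 by linarith
  qed
  have range: "0 \<le> x n \<and> x n < 1 \<and> (x n < \<gamma> / 2 \<or> \<gamma> \<le> x n)" for n
    using Lv[of 2 "(n - 1) div q"] Lv[of 3 "(n - 1) div q"] eta pos assms
    unfolding x_def two_cluster_def Let_def by auto
  have "has_PPC \<gamma> x"
    unfolding x_def using q2 L0 L1 eta
    by (intro two_cluster_has_PPC[where \<eta> = \<eta>]) (auto simp: len_def \<kappa>_def)
  moreover have "\<not> uniformly_distributed_mod1 x"
  proof
    assume "uniformly_distributed_mod1 x"
    moreover have "0 \<le> \<gamma> / 2 \<and> \<gamma> / 2 < \<gamma> \<and> \<gamma> \<le> 1" using assms by simp
    ultimately have "(\<lambda>N. real (card {n \<in> {1..N}. \<gamma> / 2 \<le> frac (x n) \<and> frac (x n) < \<gamma>}) / real N)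
        \<longlonglongrightarrow> \<gamma> - \<gamma> / 2"
      unfolding uniformly_distributed_mod1_def by blast
    moreover have "frac (x n) = x n" "\<not> (\<gamma> / 2 \<le> x n \<and> x n < \<gamma>)" for n
      using range[of n] by (simp_all add: frac_eq not_le not_less)
    then have empty: "{n \<in> {1..N}. \<gamma> / 2 \<le> frac (x n) \<and> frac (x n) < \<gamma>} = {}" for N
      by simp
    \<comment> \<open>The gap \<open>[\<gamma> / 2, \<gamma>)\<close> is never visited, although
      uniform distribution would give it the positive frequency \<open>\<gamma> / 2\<close>.\<close>
    ultimately have "(\<lambda>N::nat. 0 :: real) \<longlonglongrightarrow> \<gamma> - \<gamma> / 2"
      unfolding empty by simp
    then show False using assms by (simp add: LIMSEQ_const_iff)
  qed
  ultimately show ?thesis using range by (intro exI[of _ x]) (auto intro: less_imp_le)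
qed

end
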